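(* Suppose that $\delta$ satisfies $$\delta\le\frac{4\gamma_0}{\gamma'_{\max}+\gamma_0}.$$ If $\mathbf V^{(n)}=(V_1^{(n)},\dots,V_{n_e}^{(n)})\in(S_h^k)^{n_e}$, $n=1,\dots,n_i$, is the solution of the Crank-Nicolson system $$\left(\frac{V_i^{(n)}-V_i^{(n-1)}}{\delta},W_i\right)+a_i\big(l(\hat V_1^{(n)}),\dots,l(\hat V_{n_e}^{(n)})\big)b_2^{(n-1/2)}\left(\frac{\partial\hat V_i^{(n)}}{\partial y},\frac{\partial W_i}{\partial y}\right)-\left(b_1^{(n-1/2)}\frac{\partial\hat V_i^{(n)}}{\partial y},W_i\right)=(g_i^{(n-1/2)},W_i)$$ for all $W_i\in S_h^k$, $i=1,\dots,n_e$, where $\hat V_i^{(n)}=\frac12(V_i^{(n)}+V_i^{(n-1)})$ and $V_i^{(0)}=I_hv_{i0}$, then $$\left\|V_i^{(n)}\right\|^2\le C_1^n\left\|V_i^{(0)}\right\|^2+\sum_{l=1}^{n}C_3^{\,n-l+2}\,\delta\left\|g_i^{(l-\frac12)}\right\|^2,$$ where the constants $C_1$, $C_3$ could depend on $\gamma'_{\max}$, $\gamma_0$ and $\delta$.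
   Context: Let $n_e\ge1$ be an integer and $T>0$. Let $\alpha,\beta\in\mathcal C^2([0,T])$ with $\alpha',\beta'\in L_2(]0,T[)$, put $\gamma=\beta-\alpha$, and assume $0<\gamma_0<\gamma(t)<\gamma_1<\infty$, $|\gamma'(t)|\le\gamma'_{\max}$ and $|\alpha'(t)|\le\alpha'_{\max}$ for all $t\in[0,T]$. Put $\Omega_t=]\alpha(t),\beta(t)[$ and $\Omega=]0,1[$. For $i=1,\dots,n_e$: $u_{i0}\in H_0^1(\Omega_0)$; $f_i$ satisfies $\int_0^T\int_{\Omega_t}f_i^2\,dx\,dt<\infty$; $a_i:\mathbb R^{n_e}\to\mathbb R^+$ is Lipschitz-continuous with $0<m_a\le a_i(s)\le M_a$ for all $s\in\mathbb R^{n_e}$. Notation: $b_1(y,t)=\dfrac{\alpha'(t)+\gamma'(t)y}{\gamma(t)}$, $b_2(t)=\dfrac1{\gamma(t)^2}$, $g_i(y,t)=f_i(\alpha(t)+\gamma(t)y,t)$, $v_{i0}(y)=u_{i0}(\alpha(0)+\gamma(0)y)$. Time is discretised with step $\delta>0$, $t_n=n\delta$, $n=0,\dots,n_i$, $T=n_i\delta$, and $t_{n-1/2}=\frac{t_n+t_{n-1}}2$; a superscript $(n-1/2)$ denotes evaluation at $t_{n-1/2}$, with $g_i^{(n-1/2)}=g_i(\cdot,t_{n-1/2})$ assumed to be in $L_2(\Omega)$. In the scheme, $l(w)=\gamma(t_{n-1/2})\int_0^1w(y)\,dy$ (the summation index $l$ in the estimate is an integer, unrelated to this functional). $\|\cdot\|$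 and $(\cdot,\cdot)$ are the norm and inner product of $L_2(\Omega)$. $\mathcal T_h$ is a partition of $\Omega$ into disjoint intervals of maximal length $h$; $S_h^k$ ($k\ge1$ an integer) is the space of continuous functions on $[0,1]$ that vanish at $0$ and $1$ and are polynomials of degree $k$ on each interval of $\mathcal T_h$; $I_h$ is the Lagrange interpolation operator onto $S_h^k$. *)

theory Defs
  imports "HOL-Analysis.Analysis" "HOL-Computational_Algebra.Polynomial"
begin

section \<open>Square integrable functions and Sobolev spaces on an interval\<close>

definition square_integrable :: "'a::euclidean_space set \<Rightarrow> ('a \<Rightarrow> real) \<Rightarrow> bool" where
  "square_integrable S f \<longleftrightarrow>
     f \<in> borel_measurable (lebesgue_on S) \<and> integrable (lebesgue_on S) (\<lambda>x. (f x)\<^sup>2)"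

definition L2_inner :: "(real \<Rightarrow> real) \<Rightarrow> (real \<Rightarrow> real) \<Rightarrow> real" where
  "L2_inner u v = (LINT y|lebesgue_on {0<..<1}. u y * v y)"

definition L2_norm :: "(real \<Rightarrow> real) \<Rightarrow> real" where
  "L2_norm u = sqrt (L2_inner u u)"

definition test_functions :: "real \<Rightarrow> real \<Rightarrow> (real \<Rightarrow> real) set" where
  "test_functions a b =
     {\<phi>. (\<forall>m::nat. (deriv ^^ m) \<phi> differentiable_on UNIV) \<and>
         compact (closure {x. \<phi> x \<noteq> 0}) \<and> closure {x. \<phi> x \<noteq> 0} \<subseteq> {a<..<b}}"

definition weak_derivative :: "real \<Rightarrow> real \<Rightarrow> (real \<Rightarrow> real) \<Rightarrow> (real \<Rightarrow> real) \<Rightarrow> bool" where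
  "weak_derivative a b u g \<longleftrightarrow>
     (\<forall>\<phi>\<in>test_functions a b.
        (LINT x|lebesgue_on {a<..<b}. u x * deriv \<phi> x) =
        - (LINT x|lebesgue_on {a<..<b}. g x * \<phi> x))"

text \<open>The space \<open>H\<^sup>1\<^sub>0\<close> is the closure of the test functions in the \<open>H\<^sup>1\<close> norm. A class of
  \<open>H\<^sup>1\<^sub>0(]a,b[)\<close> is represented by its continuous representative on \<open>[a,b]\<close>, so that point values,
  which Lagrange interpolation needs, are meaningful.\<close>

definition H10 :: "real \<Rightarrow> real \<Rightarrow> (real \<Rightarrow> real) set" where
  "H10 a b =
     {u. continuous_on {a..b} u \<and> square_integrable {a<..<b} u \<and>
         (\<exists>g. square_integrable {a<..<b} g \<and> weak_derivative a b u g \<and>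
              (\<forall>\<epsilon>>0. \<exists>\<phi>\<in>test_functions a b.
                 (LINT x|lebesgue_on {a<..<b}. (u x - \<phi> x)\<^sup>2) +
                 (LINT x|lebesgue_on {a<..<b}. (g x - deriv \<phi> x)\<^sup>2) < \<epsilon>))}"

section \<open>Data of the problem\<close>

text \<open>Derivatives in time are one-sided at the end points of \<open>[0,T]\<close>.\<close>

definition time_deriv :: "real \<Rightarrow> (real \<Rightarrow> real) \<Rightarrow> real \<Rightarrow> real" where
  "time_deriv T f t = vector_derivative f (at t within {0..T})"

definition C2_on :: "real \<Rightarrow> (real \<Rightarrow> real) \<Rightarrow> bool" where
  "C2_on T f \<longleftrightarrow>
     (\<exists>f' f''. (\<forall>t\<in>{0..T}. (f has_real_derivative f' t) (at t within {0..T})) \<and>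
               (\<forall>t\<in>{0..T}. (f' has_real_derivative f'' t) (at t within {0..T})) \<and>
               continuous_on {0..T} f'')"

definition space_time :: "real \<Rightarrow> (real \<Rightarrow> real) \<Rightarrow> (real \<Rightarrow> real) \<Rightarrow> (real \<times> real) set" where
  "space_time T \<alpha> \<beta> = {(x, t). 0 < t \<and> t < T \<and> \<alpha> t < x \<and> x < \<beta> t}"

text \<open>\<open>\<real>\<^sup>n\<close> is the set of functions \<open>{1..n} \<rightarrow>\<^sub>E UNIV\<close>, with the Euclidean distance
  (the metric of the function type \<open>nat \<Rightarrow> real\<close> in the library is a different one).\<close>

definition lipschitz_Rn :: "nat \<Rightarrow> ((nat \<Rightarrow> real) \<Rightarrow> real) \<Rightarrow> bool" where
  "lipschitz_Rn n a \<longleftrightarrow>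
     (\<exists>L. \<forall>r\<in>{1..n} \<rightarrow>\<^sub>E UNIV. \<forall>s\<in>{1..n} \<rightarrow>\<^sub>E UNIV.
        \<bar>a r - a s\<bar> \<le> L * L2_set (\<lambda>j. r j - s j) {1..n})"

definition width :: "(real \<Rightarrow> real) \<Rightarrow> (real \<Rightarrow> real) \<Rightarrow> real \<Rightarrow> real" where
  "width \<alpha> \<beta> t = \<beta> t - \<alpha> t"

definition b1 :: "real \<Rightarrow> (real \<Rightarrow> real) \<Rightarrow> (real \<Rightarrow> real) \<Rightarrow> real \<Rightarrow> real \<Rightarrow> real" where
  "b1 T \<alpha> \<beta> y t =
     (time_deriv T \<alpha> t + time_deriv T (width \<alpha> \<beta>) t * y) / width \<alpha> \<beta> t"

definition b2 :: "(real \<Rightarrow> real) \<Rightarrow> (real \<Rightarrow> real) \<Rightarrow> real \<Rightarrow> real" where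
  "b2 \<alpha> \<beta> t = 1 / (width \<alpha> \<beta> t)\<^sup>2"

definition pull_back :: "(real \<Rightarrow> real) \<Rightarrow> (real \<Rightarrow> real) \<Rightarrow> (real \<Rightarrow> real \<Rightarrow> real) \<Rightarrow> real \<Rightarrow> real \<Rightarrow> real"
  where "pull_back \<alpha> \<beta> f y t = f (\<alpha> t + width \<alpha> \<beta> t * y) t"

section \<open>Finite elements\<close>

text \<open>A partition of \<open>]0,1[\<close> is given by its break points \<open>0 = x 0 < \<dots> < x N = 1\<close>.\<close>

definition is_partition :: "nat \<Rightarrow> (nat \<Rightarrow> real) \<Rightarrow> real \<Rightarrow> bool" where
  "is_partition N x h \<longleftrightarrow>
     1 \<le> N \<and> x 0 = 0 \<and> x N = 1 \<and> (\<forall>j<N. x j < x (Suc j)) \<and>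
     h = Max ((\<lambda>j. x (Suc j) - x j) ` {..<N})"

text \<open>Only the values on \<open>[0,1]\<close> of an element of the following space are meaningful.\<close>

definition fe_space :: "nat \<Rightarrow> nat \<Rightarrow> (nat \<Rightarrow> real) \<Rightarrow> (real \<Rightarrow> real) set" where
  "fe_space k N x =
     {w. continuous_on {0..1} w \<and> w 0 = 0 \<and> w 1 = 0 \<and>
         (\<forall>j<N. \<exists>p. degree p \<le> k \<and> (\<forall>y\<in>{x j..x (Suc j)}. w y = poly p y))}"

text \<open>The \<open>k + 1\<close> Lagrange nodes of an element are the images of reference nodes
  \<open>0 = \<xi> 0 < \<dots> < \<xi> k = 1\<close>; \<open>\<xi> m = m / k\<close> gives the equispaced ones.\<close>

definition reference_nodes :: "nat \<Rightarrow> (nat \<Rightarrow> real) \<Rightarrow> bool" where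
  "reference_nodes k \<xi> \<longleftrightarrow> \<xi> 0 = 0 \<and> \<xi> k = 1 \<and> (\<forall>m<k. \<xi> m < \<xi> (Suc m))"

text \<open>\<open>w = I\<^sub>h v\<close> as a relation: on \<open>[0,1]\<close> at most one element of the finite element space has the
  values of \<open>v\<close> at all the nodes, and there is one whenever \<open>v 0 = v 1 = 0\<close>.\<close>

definition is_lagrange_interpolant ::
  "nat \<Rightarrow> nat \<Rightarrow> (nat \<Rightarrow> real) \<Rightarrow> (nat \<Rightarrow> real) \<Rightarrow> (real \<Rightarrow> real) \<Rightarrow> (real \<Rightarrow> real) \<Rightarrow> bool" where
  "is_lagrange_interpolant k N x \<xi> v w \<longleftrightarrow>
     w \<in> fe_space k N x \<and>
     (\<forall>j<N. \<forall>m\<le>k. let z = x j + \<xi> m * (x (Suc j) - x j) in w z = v z)"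

section \<open>The Crank-Nicolson scheme\<close>

definition t_mid :: "real \<Rightarrow> nat \<Rightarrow> real" where
  "t_mid \<delta> n = (real n * \<delta> + real (n - 1) * \<delta>) / 2"

definition V_hat :: "(nat \<Rightarrow> nat \<Rightarrow> real \<Rightarrow> real) \<Rightarrow> nat \<Rightarrow> nat \<Rightarrow> real \<Rightarrow> real" where
  "V_hat V i n y = (V i n y + V i (n - 1) y) / 2"

definition l_functional ::
  "(real \<Rightarrow> real) \<Rightarrow> (real \<Rightarrow> real) \<Rightarrow> real \<Rightarrow> (real \<Rightarrow> real) \<Rightarrow> real" where
  "l_functional \<alpha> \<beta> t w = width \<alpha> \<beta> t * (LINT y|lebesgue_on {0..1}. w y)"

text \<open>\<open>V i n\<close> is the \<open>i\<close>-th component at time \<open>t\<^sub>n\<close>. The derivative \<open>deriv\<close> of a finite element function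
  is its derivative in \<open>y\<close> inside every element; its values at the finitely many break points do not
  affect the integrals.\<close>

definition crank_nicolson_step ::
  "nat \<Rightarrow> real \<Rightarrow> real \<Rightarrow> (real \<Rightarrow> real) \<Rightarrow> (real \<Rightarrow> real) \<Rightarrow> (nat \<Rightarrow> (nat \<Rightarrow> real) \<Rightarrow> real) \<Rightarrow>
   (nat \<Rightarrow> real \<Rightarrow> real \<Rightarrow> real) \<Rightarrow> (real \<Rightarrow> real) set \<Rightarrow> (nat \<Rightarrow> nat \<Rightarrow> real \<Rightarrow> real) \<Rightarrow> nat \<Rightarrow> bool"
  where
  "crank_nicolson_step n\<^sub>e T \<delta> \<alpha> \<beta> a f S V n \<longleftrightarrow>
     (let t = t_mid \<delta> n in
      \<forall>i\<in>{1..n\<^sub>e}. \<forall>W\<in>S.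
        L2_inner (\<lambda>y. (V i n y - V i (n - 1) y) / \<delta>) W
        + a i (\<lambda>j\<in>{1..n\<^sub>e}. l_functional \<alpha> \<beta> t (V_hat V j n)) * b2 \<alpha> \<beta> t
            * L2_inner (deriv (V_hat V i n)) (deriv W)
        - L2_inner (\<lambda>y. b1 T \<alpha> \<beta> y t * deriv (V_hat V i n) y) W
        = L2_inner (\<lambda>y. pull_back \<alpha> \<beta> (f i) y t) W)"

end

theory Submission
  imports Defs
begin

text \<open>Testing the scheme with \<open>V_hat\<close> and integrating the transport term by parts gives, for the
  norms \<open>A\<close>, \<open>B\<close> of two consecutive iterates and \<open>G\<close> of the source,
  \<open>A\<^sup>2 - B\<^sup>2 \<le> \<delta> c ((A + B) / 2)\<^sup>2 + \<delta> G (A + B)\<close> with \<open>c = \<gamma>'max / \<gamma>0\<close>. Dividing by \<open>A + B\<close>, rather than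
  applying Young's inequality to the source term, leaves \<open>(1 - \<delta> c / 4) A \<le> (1 + \<delta> c / 4) B + \<delta> G\<close>,
  and the restriction on \<open>\<delta>\<close> is what makes \<open>\<delta> c / 4 < 1\<close>.\<close>

section \<open>Square integrable functions\<close>

lemma square_integrable_mult:
  assumes "square_integrable S u" "square_integrable S v"
  shows "integrable (lebesgue_on S) (\<lambda>y. u y * v y)"
proof (rule Bochner_Integration.integrable_bound)
  show "integrable (lebesgue_on S) (\<lambda>y. (u y)\<^sup>2 + (v y)\<^sup>2)"
    using assms by (simp add: square_integrable_def)
  show "(\<lambda>y. u y * v y) \<in> borel_measurable (lebesgue_on S)"
    using assms by (auto simp: square_integrable_def intro!: borel_measurable_times)
  have "\<bar>u y * v y\<bar> \<le> (u y)\<^sup>2 + (v y)\<^sup>2" for y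
  proof -
    have "2 * (\<bar>u y\<bar> * \<bar>v y\<bar>) \<le> (u y)\<^sup>2 + (v y)\<^sup>2"
      using sum_squares_bound[of "\<bar>u y\<bar>" "\<bar>v y\<bar>"] by simp
    moreover have "0 \<le> \<bar>u y\<bar> * \<bar>v y\<bar>" by simp
    ultimately show ?thesis unfolding abs_mult by linarith
  qed
  then show "AE y in lebesgue_on S. norm (u y * v y) \<le> norm ((u y)\<^sup>2 + (v y)\<^sup>2)"
    by simp
qed

lemma square_integrable_add:
  assumes "square_integrable S u" "square_integrable S v"
  shows "square_integrable S (\<lambda>y. u y + v y)"
  using assms square_integrable_mult[OF assms]
  by (auto simp: square_integrable_def power2_sum mult.assoc)

lemma square_integrable_cmult:
  assumes "square_integrable S u"
  shows "square_integrable S (\<lambda>y. c * u y)"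
  using assms by (auto simp: square_integrable_def power_mult_distrib)

lemma L2_inner_self_nonneg: "0 \<le> L2_inner u u"
  unfolding L2_inner_def by (intro Bochner_Integration.integral_nonneg) simp

lemma L2_norm_nonneg: "0 \<le> L2_norm u"
  by (simp add: L2_norm_def L2_inner_self_nonneg)

lemma L2_norm_squared: "(L2_norm u)\<^sup>2 = L2_inner u u"
  by (simp add: L2_norm_def L2_inner_self_nonneg)

lemma L2_inner_commute: "L2_inner u v = L2_inner v u"
  by (simp add: L2_inner_def mult.commute)

lemma L2_inner_cmult_left: "L2_inner (\<lambda>y. c * u y) v = c * L2_inner u v"
  by (simp add: L2_inner_def mult.assoc)

lemma L2_inner_cmult_right: "L2_inner u (\<lambda>y. c * v y) = c * L2_inner u v"
  by (simp add: L2_inner_def mult.left_commute)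

lemma L2_inner_add_left:
  assumes "square_integrable {0<..<1} u" "square_integrable {0<..<1} v" "square_integrable {0<..<1} w"
  shows "L2_inner (\<lambda>y. u y + v y) w = L2_inner u w + L2_inner v w"
  using square_integrable_mult[OF assms(1,3)] square_integrable_mult[OF assms(2,3)]
  by (simp add: L2_inner_def distrib_right)

lemma L2_inner_add_self:
  assumes "square_integrable {0<..<1} u" "square_integrable {0<..<1} v"
  shows "L2_inner (\<lambda>y. u y + v y) (\<lambda>y. u y + v y) = L2_inner u u + 2 * L2_inner u v + L2_inner v v"
proof -
  have "L2_inner z (\<lambda>y. u y + v y) = L2_inner u z + L2_inner v z"
    if "square_integrable {0<..<1} z" for z
    using L2_inner_add_left[OF assms that] by (simp only: L2_inner_commute[of z])
  then show ?thesis
    using assms L2_inner_add_left[OF assms square_integrable_add[OF assms]]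
    by (simp add: L2_inner_commute[of v u])
qed

text \<open>The quadratic form \<open>L2_inner\<close> of \<open>s * u + r * v\<close> with itself
  is nonnegative. Keeping both variables \<open>s\<close> and \<open>r\<close> lets the same
  inequality settle the degenerate case \<open>L2_inner u u = 0\<close>.\<close>

lemma L2_Cauchy_Schwarz:
  assumes u: "square_integrable {0<..<1} u" and v: "square_integrable {0<..<1} v"
  shows "\<bar>L2_inner u v\<bar> \<le> L2_norm u * L2_norm v"
proof -
  define a b c where "a = L2_inner u u" and "b = L2_inner u v" and "c = L2_inner v v"
  have quad: "0 \<le> s\<^sup>2 * a + 2 * (s * r) * b + r\<^sup>2 * c" for s r
  proof -
    have "0 \<le> L2_inner (\<lambda>y. s * u y + r * v y) (\<lambda>y. s * u y + r * v y)"
      by (rule L2_inner_self_nonneg)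
    also have "\<dots> = s\<^sup>2 * a + 2 * (s * r) * b + r\<^sup>2 * c"
      using u v
      by (simp add: L2_inner_add_self square_integrable_cmult L2_inner_cmult_left
          L2_inner_cmult_right a_def b_def c_def power2_eq_square)
    finally show ?thesis .
  qed
  have nonneg: "0 \<le> a" "0 \<le> c" by (simp_all add: a_def c_def L2_inner_self_nonneg)
  have "b\<^sup>2 \<le> a * c"
  proof (cases "a = 0")
    case True
    \<comment> \<open>With \<open>a = 0\<close> only \<open>2 * (s * r) * b + r\<^sup>2 * c\<close>
      remains; \<open>s = - (c + 1)\<close> and \<open>r = b\<close> turn it into
      \<open>- (c + 2) * b\<^sup>2\<close>, which forces \<open>b = 0\<close>.\<close>
    have "0 \<le> 2 * (- (c + 1) * b) * b + b\<^sup>2 * c"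
      using quad[of "- (c + 1)" b] True by simp
    then have "(c + 2) * b\<^sup>2 \<le> 0" by (simp add: power2_eq_square algebra_simps)
    then show ?thesis using nonneg True by (auto simp: mult_le_0_iff)
  next
    case False
    then have "0 < a" using nonneg by simp
    \<comment> \<open>The choice \<open>s = - b\<close>, \<open>r = a\<close> is the minimiser of
      the form, cleared of denominators.\<close>
    have "0 \<le> a * (a * c - b\<^sup>2)"
      using quad[of "- b" a] by (simp add: power2_eq_square algebra_simps)
    then show ?thesis using \<open>0 < a\<close> by (simp add: zero_le_mult_iff)
  qed
  then have "sqrt (b\<^sup>2) \<le> sqrt (a * c)" by (rule real_sqrt_le_mono)
  then show ?thesis by (simp add: L2_norm_def real_sqrt_mult a_def b_def c_def)
qed

text \<open>Expanding the square and bounding the mixed term by Cauchy-Schwarz gives the triangle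
  inequality in the form that fits \<open>V_hat\<close>.\<close>

lemma L2_norm_average_le:
  assumes u: "square_integrable {0<..<1} u" and v: "square_integrable {0<..<1} v"
  shows "L2_norm (\<lambda>y. (u y + v y) / 2) \<le> (L2_norm u + L2_norm v) / 2"
proof (rule power2_le_imp_le)
  have "(L2_norm (\<lambda>y. (u y + v y) / 2))\<^sup>2
      = L2_inner (\<lambda>y. (1/2) * (u y + v y)) (\<lambda>y. (1/2) * (u y + v y))"
    by (simp add: L2_norm_squared)
  also have "\<dots> = (L2_inner u u + 2 * L2_inner u v + L2_inner v v) / 4"
    using L2_inner_add_self[OF u v]
    by (simp only: L2_inner_cmult_left L2_inner_cmult_right)
  also have "\<dots> \<le> ((L2_norm u)\<^sup>2 + 2 * (L2_norm u * L2_norm v) + (L2_norm v)\<^sup>2) / 4"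
    using L2_Cauchy_Schwarz[OF u v] by (simp add: L2_norm_squared)
  also have "\<dots> = ((L2_norm u + L2_norm v) / 2)\<^sup>2"
    by (simp add: power2_eq_square field_simps)
  finally show "(L2_norm (\<lambda>y. (u y + v y) / 2))\<^sup>2 \<le> ((L2_norm u + L2_norm v) / 2)\<^sup>2" .
qed (simp add: L2_norm_nonneg)

lemma integrable_unit_interval_bounded:
  fixes u :: "real \<Rightarrow> real"
  assumes "u \<in> borel_measurable (lebesgue_on {0<..<1})" "\<And>y. y \<in> {0<..<1} \<Longrightarrow> \<bar>u y\<bar> \<le> C"
  shows "integrable (lebesgue_on {0<..<1}) u"
proof -
  interpret finite_measure "lebesgue_on {0<..<1::real}"
    by (rule finite_measure_lebesgue_on) simp
  show ?thesis
    using assms by (intro integrable_const_bound[where B = C]) auto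
qed

lemma continuous_on_unit_interval_bounded:
  fixes w :: "real \<Rightarrow> real"
  assumes "continuous_on {0..1} w"
  obtains C where "0 \<le> C" "\<And>y. y \<in> {0..1} \<Longrightarrow> \<bar>w y\<bar> \<le> C"
proof -
  have "bounded (w ` {0..1})"
    by (intro compact_imp_bounded compact_continuous_image assms) simp
  then obtain C where C: "\<forall>y\<in>{0..1}. \<bar>w y\<bar> \<le> C" by (auto simp: bounded_iff)
  then have "0 \<le> C" using order_trans[OF abs_ge_zero, of "w 0" C] by simp
  then show ?thesis using C that by blast
qed

lemma square_integrable_continuous:
  fixes w :: "real \<Rightarrow> real"
  assumes "continuous_on {0..1} w"
  shows "square_integrable {0<..<1} w"
proof -
  obtain C where "0 \<le> C" and C: "\<And>y. y \<in> {0..1} \<Longrightarrow> \<bar>w y\<bar> \<le> C"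
    using continuous_on_unit_interval_bounded[OF assms] by blast
  have meas: "w \<in> borel_measurable (lebesgue_on {0<..<1})"
    by (intro continuous_imp_measurable_on_sets_lebesgue continuous_on_subset[OF assms]) auto
  moreover have "integrable (lebesgue_on {0<..<1}) (\<lambda>y. (w y)\<^sup>2)"
  proof (rule integrable_unit_interval_bounded)
    show "\<bar>(w y)\<^sup>2\<bar> \<le> C\<^sup>2" if "y \<in> {0<..<1}" for y
      using power_mono[OF C, of y 2] that by simp
  qed (use meas in simp)
  ultimately show ?thesis by (simp add: square_integrable_def)
qed

section \<open>Finite element functions\<close>

text \<open>Makes \<open>V_hat\<close> an admissible test function.\<close>

lemma fe_space_average:
  assumes "u \<in> fe_space k N x" "v \<in> fe_space k N x"
  shows "(\<lambda>y. (u y + v y) / 2) \<in> fe_space k N x"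
proof -
  have "\<exists>p. degree p \<le> k \<and> (\<forall>y\<in>{x j..x (Suc j)}. (u y + v y) / 2 = poly p y)" if "j < N" for j
  proof -
    obtain p q where "degree p \<le> k" "\<forall>y\<in>{x j..x (Suc j)}. u y = poly p y"
      and "degree q \<le> k" "\<forall>y\<in>{x j..x (Suc j)}. v y = poly q y"
      using assms \<open>j < N\<close> unfolding fe_space_def by blast
    then show ?thesis
      by (intro exI[of _ "smult (1/2) (p + q)"]) (auto intro: degree_add_le)
  qed
  then show ?thesis using assms by (auto simp: fe_space_def intro!: continuous_intros)
qed

lemma partition_element:
  fixes x :: "nat \<Rightarrow> real"
  assumes "x 0 \<le> y" "y < x m"
  shows "\<exists>j<m. x j \<le> y \<and> y < x (Suc j)"
  using assms
proof (induction m)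
  case (Suc m)
  then show ?case by (cases "y < x m") (auto intro: less_SucI simp: not_less)
qed simp

text \<open>Inside an element \<open>w\<close> is a polynomial, so \<open>deriv w\<close> is a
  genuine derivative off the break points, which is what the fundamental theorem of calculus with a
  finite exceptional set asks for. The bound \<open>D\<close> covers the break points as well, so
  that it can serve as a pointwise bound for integrability.\<close>

lemma fe_space_deriv:
  assumes w: "w \<in> fe_space k N x" and part: "is_partition N x h"
  obtains D where "\<And>y. y \<in> {0<..<1} - x ` {..N} \<Longrightarrow> (w has_real_derivative deriv w y) (at y)"
    and "0 \<le> D" and "\<And>y. y \<in> {0<..<1} \<Longrightarrow> \<bar>deriv w y\<bar> \<le> D"
proof -
  have "\<forall>j<N. \<exists>p. \<forall>y\<in>{x j..x (Suc j)}. w y = poly p y"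
    using w unfolding fe_space_def by blast
  then obtain p where p: "\<And>j y. j < N \<Longrightarrow> y \<in> {x j..x (Suc j)} \<Longrightarrow> w y = poly (p j) y"
    by metis
  have poly_deriv: "(w has_real_derivative poly (pderiv (p j)) y) (at y)"
    if "j < N" "x j < y" "y < x (Suc j)" for j y
  proof (rule has_field_derivative_transform_within_open)
    show "(poly (p j) has_real_derivative poly (pderiv (p j)) y) (at y)" by (rule poly_DERIV)
    show "open {x j<..<x (Suc j)}" by simp
  qed (use that p in auto)
  have element: "\<exists>j<N. x j < y \<and> y < x (Suc j)" if "y \<in> {0<..<1} - x ` {..N}" for y
  proof -
    have "x 0 \<le> y" "y < x N" using part that by (auto simp: is_partition_def)
    then obtain j where j: "j < N" "x j \<le> y" "y < x (Suc j)"
      using partition_element by blast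
    moreover have "y \<noteq> x j" using that j by auto
    ultimately show ?thesis by force
  qed
  \<comment> \<open>All values that \<open>deriv w\<close> can take: finitely many at the break
    points, whatever \<open>deriv\<close> yields there, and the images of the compact elements under
    polynomials. Each piece is bounded.\<close>
  define Y where "Y = deriv w ` (x ` {..N}) \<union> (\<Union>j<N. poly (pderiv (p j)) ` {x j..x (Suc j)})"
  have "bounded Y"
    unfolding Y_def
    by (intro bounded_Un[THEN iffD2] conjI bounded_UN ballI finite_imp_bounded finite_imageI
        finite_atMost finite_lessThan compact_imp_bounded compact_continuous_image
        continuous_on_poly continuous_on_id compact_Icc)
  then obtain D where D: "\<And>z. z \<in> Y \<Longrightarrow> \<bar>z\<bar> \<le> D" by (auto simp: bounded_iff)
  have "deriv w y \<in> Y" if "y \<in> {0<..<1}" for y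
  proof (cases "y \<in> x ` {..N}")
    case False
    then have "y \<in> {0<..<1} - x ` {..N}" using that by simp
    then obtain j where j: "j < N" "x j < y" "y < x (Suc j)" using element by blast
    then have "deriv w y = poly (pderiv (p j)) y" using poly_deriv DERIV_imp_deriv by blast
    then show ?thesis using j by (force simp: Y_def)
  qed (simp add: Y_def)
  then have bd: "\<bar>deriv w y\<bar> \<le> D" if "y \<in> {0<..<1}" for y using D that by blast
  then have "0 \<le> D" using order_trans[OF abs_ge_zero, of "deriv w (1/2)" D] by simp
  moreover have "(w has_real_derivative deriv w y) (at y)" if "y \<in> {0<..<1} - x ` {..N}" for y
    using element[OF that] poly_deriv DERIV_imp_deriv by metis
  ultimately show ?thesis using bd that by blast
qed

text \<open>\<open>(r + s * y) * w' * w\<close> is the derivative of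
  \<open>(r + s * y) * w\<^sup>2 / 2\<close> minus \<open>s / 2 * w\<^sup>2\<close>, and the
  boundary terms vanish because \<open>w\<close> is zero at 0 and 1. Only the slope \<open>s\<close>
  survives: the constant part \<open>r\<close>, which carries \<alpha>', leaves no trace in the
  final constants.\<close>

lemma fe_space_transport_by_parts:
  assumes w: "w \<in> fe_space k N x" and part: "is_partition N x h"
  shows "L2_inner (\<lambda>y. (r + s * y) * deriv w y) w = - (s / 2) * L2_inner w w"
proof -
  obtain D where deriv: "\<And>y. y \<in> {0<..<1} - x ` {..N} \<Longrightarrow> (w has_real_derivative deriv w y) (at y)"
    and "0 \<le> D" and D: "\<And>y. y \<in> {0<..<1} \<Longrightarrow> \<bar>deriv w y\<bar> \<le> D"
    using fe_space_deriv[OF w part] by blast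
  have cont: "continuous_on {0..1} w" and w01: "w 0 = 0" "w 1 = 0"
    using w by (auto simp: fe_space_def)
  obtain C where "0 \<le> C" and C: "\<And>y. y \<in> {0..1} \<Longrightarrow> \<bar>w y\<bar> \<le> C"
    using continuous_on_unit_interval_bounded[OF cont] by blast
  define F where "F y = (r + s * y) * (w y)\<^sup>2 / 2" for y
  define F' where "F' y = (r + s * y) * deriv w y * w y + s / 2 * (w y * w y)" for y
  have "(F' has_integral F 1 - F 0) {0..1}"
  proof (rule fundamental_theorem_of_calculus_interior_strong)
    show "finite (x ` {..N})" by simp
    show "continuous_on {0..1} F" unfolding F_def by (intro continuous_intros cont) auto
    show "(F has_vector_derivative F' y) (at y)" if "y \<in> {0<..<1} - x ` {..N}" for y
      unfolding F_def F'_def has_real_derivative_iff_has_vector_derivative[symmetric]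
      by (rule derivative_eq_intros deriv[OF that] refl | simp add: power2_eq_square field_simps)+
  qed simp
  then have int0: "(F' has_integral 0) {0<..<1}"
    by (simp add: F_def w01 has_integral_Icc_iff_Ioo)
  have ww: "integrable (lebesgue_on {0<..<1}) (\<lambda>y. w y * w y)"
    by (intro square_integrable_mult square_integrable_continuous cont)
  \<comment> \<open>Measurability of the term with \<open>deriv w\<close> is read off from the gauge
    integrability of \<open>F'\<close>, after subtracting the continuous part
    \<open>s / 2 * (w y * w y)\<close>.\<close>
  have "F' \<in> borel_measurable (lebesgue_on {0<..<1})"
    using int0 by (blast intro: integrable_imp_measurable)
  then have "(\<lambda>y. F' y - s / 2 * (w y * w y)) \<in> borel_measurable (lebesgue_on {0<..<1})"
    using ww by (intro borel_measurable_diff) auto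
  then have "(\<lambda>y. (r + s * y) * deriv w y * w y) \<in> borel_measurable (lebesgue_on {0<..<1})"
    by (simp add: F'_def)
  then have ww': "integrable (lebesgue_on {0<..<1}) (\<lambda>y. (r + s * y) * deriv w y * w y)"
  proof (rule integrable_unit_interval_bounded)
    fix y :: real assume y: "y \<in> {0<..<1}"
    have "\<bar>r + s * y\<bar> \<le> \<bar>r\<bar> + \<bar>s\<bar> * \<bar>y\<bar>" by (metis abs_mult abs_triangle_ineq)
    also have "\<dots> \<le> \<bar>r\<bar> + \<bar>s\<bar>" using y by (simp add: mult_left_le)
    finally show "\<bar>(r + s * y) * deriv w y * w y\<bar> \<le> (\<bar>r\<bar> + \<bar>s\<bar>) * D * C"
      unfolding abs_mult using y D C \<open>0 \<le> C\<close> \<open>0 \<le> D\<close> by (intro mult_mono) auto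
  qed
  have "integrable (lebesgue_on {0<..<1}) F'"
    unfolding F'_def using ww ww' by simp
  \<comment> \<open>Once \<open>F'\<close> is Lebesgue integrable, its Lebesgue integral is also its
    gauge integral, already known to be 0.\<close>
  then have "(LINT y|lebesgue_on {0<..<1}. F' y) = 0"
    by (intro has_integral_unique[OF has_integral_integral_lebesgue_on int0]) simp_all
  then show ?thesis
    using ww ww' unfolding F'_def L2_inner_def by simp
qed

section \<open>The energy estimate\<close>

text \<open>The components are coupled only through the argument of \<open>a i\<close> in the
  diffusion term. After testing, that term is nonnegative and is dropped, so each component is
  estimated separately and the nonlinearity disappears.\<close>

lemma crank_nicolson_energy_bound:
  assumes step: "crank_nicolson_step n\<^sub>e T \<delta> \<alpha> \<beta> a f (fe_space k N x) V n"
    and i: "i \<in> {1..n\<^sub>e}" and part: "is_partition N x h"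
    and V: "V i n \<in> fe_space k N x" "V i (n - 1) \<in> fe_space k N x"
    and a: "\<And>s. s \<in> {1..n\<^sub>e} \<rightarrow>\<^sub>E UNIV \<Longrightarrow> 0 \<le> a i s"
    and g: "square_integrable {0<..<1} (\<lambda>y. pull_back \<alpha> \<beta> (f i) y (t_mid \<delta> n))"
    and \<gamma>: "0 < \<gamma>0" "\<gamma>0 \<le> width \<alpha> \<beta> (t_mid \<delta> n)"
    and \<gamma>': "\<bar>time_deriv T (width \<alpha> \<beta>) (t_mid \<delta> n)\<bar> \<le> \<gamma>'max"
    and "0 < \<delta>"
  defines "A \<equiv> L2_norm (V i n)" and "B \<equiv> L2_norm (V i (n - 1))"
    and "G \<equiv> L2_norm (\<lambda>y. pull_back \<alpha> \<beta> (f i) y (t_mid \<delta> n))"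
  shows "A - B \<le> \<delta> * (\<gamma>'max / \<gamma>0) / 4 * (A + B) + \<delta> * G"
proof -
  define t where "t = t_mid \<delta> n"
  define u v w g where "u = V i n" and "v = V i (n - 1)" and "w = V_hat V i n"
    and "g = (\<lambda>y. pull_back \<alpha> \<beta> (f i) y t)"
  define s where "s = time_deriv T (width \<alpha> \<beta>) t / width \<alpha> \<beta> t"
  define c where "c = \<gamma>'max / \<gamma>0"
  have w_eq: "w = (\<lambda>y. (u y + v y) / 2)" by (simp add: fun_eq_iff w_def V_hat_def u_def v_def)
  have w: "w \<in> fe_space k N x"
    unfolding w_eq using V by (intro fe_space_average) (simp_all add: u_def v_def)
  have sq: "square_integrable {0<..<1} u" "square_integrable {0<..<1} v"
    "square_integrable {0<..<1} w" "square_integrable {0<..<1} g"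
    using V w g by (auto simp: u_def v_def g_def t_def fe_space_def intro: square_integrable_continuous)
  have "0 \<le> c" using \<gamma> \<gamma>' abs_ge_zero unfolding c_def by (smt (verit) divide_nonneg_pos)
  have "\<bar>s\<bar> \<le> c"
    unfolding s_def c_def abs_divide using \<gamma> \<gamma>' by (intro frac_le) (auto simp: t_def)
  have nonneg: "0 \<le> A" "0 \<le> B" "0 \<le> G" by (simp_all add: A_def B_def G_def L2_norm_nonneg)
  have norm_w: "L2_norm w \<le> (A + B) / 2"
    using L2_norm_average_le[OF sq(1,2)] by (simp only: w_eq A_def B_def u_def v_def)
  \<comment> \<open>The test function is the half-sum of \<open>u\<close> and \<open>v\<close>, so
    the mixed products cancel and a difference of squares remains.\<close>
  have increment: "L2_inner (\<lambda>y. (u y - v y) / \<delta>) w = (A\<^sup>2 - B\<^sup>2) / (2 * \<delta>)"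
  proof -
    have sqm: "square_integrable {0<..<1} (\<lambda>y. - 1 * v y)"
      using sq(2) by (rule square_integrable_cmult)
    have uw: "L2_inner z w = (L2_inner u z + L2_inner v z) / 2" if "square_integrable {0<..<1} z" for z
    proof -
      have "L2_inner z w = L2_inner (\<lambda>y. (1/2) * (u y + v y)) z"
        by (simp add: w_eq L2_inner_commute[of z])
      then show ?thesis
        using L2_inner_add_left[OF sq(1,2) that] by (simp only: L2_inner_cmult_left)
    qed
    have "L2_inner (\<lambda>y. (u y - v y) / \<delta>) w = L2_inner (\<lambda>y. (1 / \<delta>) * (u y + - 1 * v y)) w"
      by simp
    also have "\<dots> = (1 / \<delta>) * (L2_inner u w - L2_inner v w)"
      unfolding L2_inner_cmult_left L2_inner_add_left[OF sq(1) sqm sq(3)] by simp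
    also have "\<dots> = (A\<^sup>2 - B\<^sup>2) / (2 * \<delta>)"
      using uw[OF sq(1)] uw[OF sq(2)] L2_inner_commute[of u v]
      unfolding A_def B_def L2_norm_squared u_def[symmetric] v_def[symmetric]
      by (simp add: diff_divide_distrib add_divide_distrib)
    finally show ?thesis .
  qed
  \<comment> \<open>\<open>b1\<close> is affine in \<open>y\<close>, with slope \<open>s\<close> and
    intercept \<alpha>' divided by the width.\<close>
  have transport: "L2_inner (\<lambda>y. b1 T \<alpha> \<beta> y t * deriv w y) w = - (s / 2) * L2_inner w w"
    using fe_space_transport_by_parts[OF w part, of "time_deriv T \<alpha> t / width \<alpha> \<beta> t" s]
    by (simp add: b1_def s_def add_divide_distrib)
  define K where
    "K = a i (\<lambda>j\<in>{1..n\<^sub>e}. l_functional \<alpha> \<beta> t (V_hat V j n)) * b2 \<alpha> \<beta> t * L2_inner (deriv w) (deriv w)"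
  \<comment> \<open>The argument of \<open>a i\<close> is a function restricted to
    \<open>{1..n\<^sub>e}\<close>, hence lies in the set on which \<open>a i\<close> is assumed
    nonnegative.\<close>
  have "0 \<le> K" unfolding K_def
    by (intro mult_nonneg_nonneg a L2_inner_self_nonneg) (auto simp: b2_def)
  have "L2_inner (\<lambda>y. (u y - v y) / \<delta>) w + K - L2_inner (\<lambda>y. b1 T \<alpha> \<beta> y t * deriv w y) w = L2_inner g w"
    using step i w unfolding crank_nicolson_step_def Let_def K_def t_def u_def v_def w_def g_def
    by blast
  then have "(A\<^sup>2 - B\<^sup>2) / (2 * \<delta>) \<le> L2_inner g w - s / 2 * (L2_norm w)\<^sup>2"
    using \<open>0 \<le> K\<close> by (simp add: increment transport L2_norm_squared)
  also have "\<dots> \<le> G * L2_norm w + c / 2 * (L2_norm w)\<^sup>2"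
  proof -
    have "L2_inner g w \<le> G * L2_norm w"
      using L2_Cauchy_Schwarz[OF sq(4,3)] by (simp add: G_def g_def t_def)
    moreover have "- s / 2 * (L2_norm w)\<^sup>2 \<le> c / 2 * (L2_norm w)\<^sup>2"
      using \<open>\<bar>s\<bar> \<le> c\<close> by (intro mult_right_mono) auto
    ultimately show ?thesis by simp
  qed
  \<comment> \<open>With the norm of \<open>w\<close> replaced by \<open>(A + B) / 2\<close>, both
    sides contain the factor \<open>A + B\<close>.\<close>
  also have "\<dots> \<le> G * ((A + B) / 2) + c / 2 * ((A + B) / 2)\<^sup>2"
    using norm_w nonneg \<open>0 \<le> c\<close>
    by (intro add_mono mult_left_mono power_mono) (auto simp: L2_norm_nonneg)
  finally have "(A - B) * (A + B) \<le> (\<delta> * c / 4 * (A + B) + \<delta> * G) * (A + B)"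
    using \<open>0 < \<delta>\<close> by (simp add: power2_eq_square field_simps)
  \<comment> \<open>The factor \<open>A + B\<close> cannot be cancelled when it is 0; then both
    norms vanish and the claim reduces to \<open>0 \<le> \<delta> * G\<close>.\<close>
  moreover have "A - B \<le> \<delta> * c / 4 * (A + B) + \<delta> * G" if "A + B = 0"
  proof -
    have "A = 0" "B = 0" using that nonneg by linarith+
    then show ?thesis using nonneg \<open>0 < \<delta>\<close> by simp
  qed
  ultimately show ?thesis
    using nonneg unfolding c_def by (cases "A + B = 0") (auto simp: mult_le_cancel_right)
qed

text \<open>A source entering at time \<open>l\<close> carries the weight \<open>K\<close>, absorbed
  by \<open>D\<^sup>2\<close>; each of the \<open>n - l\<close> later steps multiplies it by
  \<open>C\<close>, which is at most \<open>D\<close>. This explains the exponent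
  \<open>n - l + 2\<close>.\<close>

lemma discrete_Gronwall:
  fixes e g :: "nat \<Rightarrow> real"
  assumes step: "\<And>l. l \<in> {1..m} \<Longrightarrow> e l \<le> C * e (l - 1) + K * \<delta> * g l"
    and C: "0 \<le> C" "C \<le> D" and K: "K \<le> D\<^sup>2"
    and nonneg: "0 \<le> \<delta>" "\<And>l. 0 \<le> g l" and "n \<le> m"
  shows "e n \<le> C ^ n * e 0 + (\<Sum>l=1..n. D ^ (n - l + 2) * \<delta> * g l)"
  using \<open>n \<le> m\<close>
proof (induction n)
  case (Suc n)
  have "e (Suc n) \<le> C * e n + K * \<delta> * g (Suc n)" using step[of "Suc n"] Suc.prems by simp
  also have "\<dots> \<le> C * (C ^ n * e 0 + (\<Sum>l=1..n. D ^ (n - l + 2) * \<delta> * g l)) + D\<^sup>2 * \<delta> * g (Suc n)"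
    using Suc nonneg C K by (intro add_mono mult_left_mono mult_right_mono) auto
  also have "\<dots> = C ^ Suc n * e 0 + (\<Sum>l=1..n. C * (D ^ (n - l + 2) * \<delta> * g l)) + D\<^sup>2 * \<delta> * g (Suc n)"
    by (simp add: distrib_left sum_distrib_left)
  also have "\<dots> \<le> C ^ Suc n * e 0 + (\<Sum>l=1..n. D ^ (Suc n - l + 2) * \<delta> * g l) + D\<^sup>2 * \<delta> * g (Suc n)"
  proof (intro add_mono sum_mono order_refl)
    fix l assume "l \<in> {1..n}"
    then have "D ^ (Suc n - l + 2) * \<delta> * g l = D * (D ^ (n - l + 2) * \<delta> * g l)"
      by (simp add: Suc_diff_le mult.assoc)
    moreover have "C * (D ^ (n - l + 2) * \<delta> * g l) \<le> D * (D ^ (n - l + 2) * \<delta> * g l)"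
      using C nonneg by (intro mult_right_mono mult_nonneg_nonneg) auto
    ultimately show "C * (D ^ (n - l + 2) * \<delta> * g l) \<le> D ^ (Suc n - l + 2) * \<delta> * g l"
      by (simp only:)
  qed
  \<comment> \<open>The separate source term is the summand \<open>l = Suc n\<close>, whose exponent
    is exactly 2.\<close>
  finally show ?case by (simp add: power2_eq_square)
qed simp

text \<open>Solve for \<open>A\<close>, dividing by \<open>1 - q\<close>, and square with
  \<open>(X + Y)\<^sup>2 \<le> 2 * X\<^sup>2 + 2 * Y\<^sup>2\<close>. Of the two factors \<delta> in
  the source term, one stays outside the constant to match the weight \<delta> in the final
  sum.\<close>

lemma squared_recursion:
  fixes A B G q \<delta> :: real
  assumes "A - B \<le> q * (A + B) + \<delta> * G" "0 \<le> A" "q < 1" "0 < \<delta>"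
  shows "A\<^sup>2 \<le> 2 * ((1 + q) / (1 - q))\<^sup>2 * B\<^sup>2 + 2 * \<delta> / (1 - q)\<^sup>2 * \<delta> * G\<^sup>2"
proof -
  define X Y where "X = (1 + q) / (1 - q) * B" and "Y = \<delta> / (1 - q) * G"
  have "A * (1 - q) \<le> (1 + q) * B + \<delta> * G"
    using assms by (simp add: algebra_simps)
  then have "A \<le> ((1 + q) * B + \<delta> * G) / (1 - q)"
    using assms by (simp add: pos_le_divide_eq)
  then have "A \<le> X + Y" unfolding X_def Y_def by (simp add: add_divide_distrib[of "_ * B"])
  then have "A\<^sup>2 \<le> (X + Y)\<^sup>2" using assms by (intro power_mono)
  also have "\<dots> \<le> 2 * X\<^sup>2 + 2 * Y\<^sup>2"
    using sum_squares_bound[of X Y] by (simp add: power2_sum)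
  finally show ?thesis
    by (simp add: X_def Y_def power_mult_distrib power_divide power2_eq_square mult_ac)
qed

text \<open>\<open>C1\<close> and \<open>C3\<close> are bound before the final time, the mesh, the
  coefficients and all other data, so they can depend on \<open>\<gamma>0\<close>,
  \<open>\<gamma>'max\<close> and \<open>\<delta>\<close> alone.\<close>

theorem theorem12:
  fixes \<gamma>0 \<gamma>'max \<delta> :: real
  assumes "0 < \<gamma>0" and "0 < \<delta>" and "\<delta> \<le> 4 * \<gamma>0 / (\<gamma>'max + \<gamma>0)"
  shows "\<exists>C1 C3 :: real. 0 < C1 \<and> 0 < C3 \<and>
    (\<forall>(n\<^sub>e::nat) (n\<^sub>i::nat) (T::real) (\<alpha>::real \<Rightarrow> real) (\<beta>::real \<Rightarrow> real) (\<gamma>1::real) (\<alpha>'max::real)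
      (u0::nat \<Rightarrow> real \<Rightarrow> real) (f::nat \<Rightarrow> real \<Rightarrow> real \<Rightarrow> real)
      (a::nat \<Rightarrow> (nat \<Rightarrow> real) \<Rightarrow> real) (m\<^sub>a::real) (M\<^sub>a::real)
      (k::nat) (N::nat) (x::nat \<Rightarrow> real) (h::real) (\<xi>::nat \<Rightarrow> real)
      (V::nat \<Rightarrow> nat \<Rightarrow> real \<Rightarrow> real).
        1 \<le> n\<^sub>e \<and> 0 < T \<and> T = real n\<^sub>i * \<delta> \<and>
        C2_on T \<alpha> \<and> C2_on T \<beta> \<and>
        square_integrable {0<..<T} (time_deriv T \<alpha>) \<and>
        square_integrable {0<..<T} (time_deriv T \<beta>) \<and>
        (\<forall>t\<in>{0..T}. \<gamma>0 < width \<alpha> \<beta> t \<and> width \<alpha> \<beta> t < \<gamma>1) \<and>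
        (\<forall>t\<in>{0..T}. \<bar>time_deriv T (width \<alpha> \<beta>) t\<bar> \<le> \<gamma>'max) \<and>
        (\<forall>t\<in>{0..T}. \<bar>time_deriv T \<alpha> t\<bar> \<le> \<alpha>'max) \<and>
        (\<forall>i\<in>{1..n\<^sub>e}. u0 i \<in> H10 (\<alpha> 0) (\<beta> 0)) \<and>
        (\<forall>i\<in>{1..n\<^sub>e}. square_integrable (space_time T \<alpha> \<beta>) (\<lambda>(x, t). f i x t)) \<and>
        (\<forall>i\<in>{1..n\<^sub>e}. \<forall>n\<in>{1..n\<^sub>i}.
           square_integrable {0<..<1} (\<lambda>y. pull_back \<alpha> \<beta> (f i) y (t_mid \<delta> n))) \<and>
        0 < m\<^sub>a \<and>
        (\<forall>i\<in>{1..n\<^sub>e}. lipschitz_Rn n\<^sub>e (a i) \<and>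
           (\<forall>s\<in>{1..n\<^sub>e} \<rightarrow>\<^sub>E UNIV. m\<^sub>a \<le> a i s \<and> a i s \<le> M\<^sub>a)) \<and>
        1 \<le> k \<and> is_partition N x h \<and> reference_nodes k \<xi> \<and>
        (\<forall>i\<in>{1..n\<^sub>e}. is_lagrange_interpolant k N x \<xi>
           (\<lambda>y. u0 i (\<alpha> 0 + width \<alpha> \<beta> 0 * y)) (V i 0)) \<and>
        (\<forall>i\<in>{1..n\<^sub>e}. \<forall>n\<in>{1..n\<^sub>i}. V i n \<in> fe_space k N x) \<and>
        (\<forall>n\<in>{1..n\<^sub>i}. crank_nicolson_step n\<^sub>e T \<delta> \<alpha> \<beta> a f (fe_space k N x) V n)
      \<longrightarrow>
        (\<forall>i\<in>{1..n\<^sub>e}. \<forall>n\<in>{1..n\<^sub>i}.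
           (L2_norm (V i n))\<^sup>2 \<le> C1 ^ n * (L2_norm (V i 0))\<^sup>2
             + (\<Sum>l=1..n. C3 ^ (n - l + 2) * \<delta> *
                  (L2_norm (\<lambda>y. pull_back \<alpha> \<beta> (f i) y (t_mid \<delta> l)))\<^sup>2)))"
proof -
  \<comment> \<open>No data exist when \<open>\<gamma>'max < 0\<close>, but \<open>C1\<close> and \<open>C3\<close> have to be positive nevertheless.\<close>
  define \<mu> where "\<mu> = max 0 \<gamma>'max"
  \<comment> \<open>The coefficient of \<open>A + B\<close> in the energy bound, with
    \<open>\<mu>\<close> in place of \<open>\<gamma>'max\<close>.\<close>
  define q where "q = \<delta> * (\<mu> / \<gamma>0) / 4"
  \<comment> \<open>The sign of the denominator is extracted from the restriction on \<delta>: a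
    positive number lies below the quotient, and the numerator is positive.\<close>
  have "0 < 4 * \<gamma>0 / (\<gamma>'max + \<gamma>0)" using assms by linarith
  then have "0 < \<gamma>'max + \<gamma>0" using assms by (simp add: zero_less_divide_iff)
  then have "\<delta> * (\<gamma>'max + \<gamma>0) \<le> 4 * \<gamma>0"
    using assms by (simp add: pos_le_divide_eq)
  \<comment> \<open>The summand \<open>\<gamma>0\<close> in the denominator of the restriction
    supplies the strictness: \<open>\<delta> * \<gamma>'max\<close> is at most
    \<open>4 * \<gamma>0 - \<delta> * \<gamma>0\<close>.\<close>
  moreover have "0 < \<delta> * \<gamma>0" using assms by simp
  ultimately have "\<delta> * \<gamma>'max < 4 * \<gamma>0" unfolding distrib_left by linarith
  then have "\<delta> * \<mu> < 4 * \<gamma>0" using assms by (simp add: \<mu>_def max_def)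
  then have "q < 1" using assms by (simp add: q_def pos_divide_less_eq)
  have "0 \<le> q" using assms by (simp add: q_def \<mu>_def)
  \<comment> \<open>\<open>C1\<close> and \<open>K\<close> are the coefficients produced by
    \<open>squared_recursion\<close>. The entry 1 in the maximum gives
    \<open>C3 \<le> C3\<^sup>2\<close>, hence \<open>K \<le> C3\<^sup>2\<close> as the Gronwall step
    requires.\<close>
  define C1 K C3 where "C1 = 2 * ((1 + q) / (1 - q))\<^sup>2" and "K = 2 * \<delta> / (1 - q)\<^sup>2"
    and "C3 = Max {1, C1, K}"
  have "0 < C1" using \<open>0 \<le> q\<close> \<open>q < 1\<close> by (auto simp: C1_def)
  have C3: "1 \<le> C3" "C1 \<le> C3" "K \<le> C3" by (simp_all add: C3_def)
  moreover have "C3 \<le> C3\<^sup>2" using C3(1) by (simp add: power2_eq_square)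
  ultimately have "K \<le> C3\<^sup>2" by linarith
  show ?thesis
  proof (rule exI[of _ C1], rule exI[of _ C3], (intro conjI allI impI ballI; (elim conjE)?))
    show "0 < C1" by fact
    show "0 < C3" using C3 by simp
  next
    fix n\<^sub>e n\<^sub>i :: nat and T :: real and \<alpha> \<beta> :: "real \<Rightarrow> real" and \<gamma>1 :: real
      and u0 :: "nat \<Rightarrow> real \<Rightarrow> real" and f :: "nat \<Rightarrow> real \<Rightarrow> real \<Rightarrow> real"
      and a :: "nat \<Rightarrow> (nat \<Rightarrow> real) \<Rightarrow> real" and m\<^sub>a M\<^sub>a :: real
      and k N :: nat and x :: "nat \<Rightarrow> real" and h :: real and \<xi> :: "nat \<Rightarrow> real"
      and V :: "nat \<Rightarrow> nat \<Rightarrow> real \<Rightarrow> real" and i n :: nat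
    assume T: "0 < T" "T = real n\<^sub>i * \<delta>"
      and width: "\<forall>t\<in>{0..T}. \<gamma>0 < width \<alpha> \<beta> t \<and> width \<alpha> \<beta> t < \<gamma>1"
      and width': "\<forall>t\<in>{0..T}. \<bar>time_deriv T (width \<alpha> \<beta>) t\<bar> \<le> \<gamma>'max"
      and g: "\<forall>i\<in>{1..n\<^sub>e}. \<forall>n\<in>{1..n\<^sub>i}.
           square_integrable {0<..<1} (\<lambda>y. pull_back \<alpha> \<beta> (f i) y (t_mid \<delta> n))"
      and a: "0 < m\<^sub>a" "\<forall>i\<in>{1..n\<^sub>e}. lipschitz_Rn n\<^sub>e (a i) \<and>
           (\<forall>s\<in>{1..n\<^sub>e} \<rightarrow>\<^sub>E UNIV. m\<^sub>a \<le> a i s \<and> a i s \<le> M\<^sub>a)"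
      and part: "is_partition N x h"
      and V0: "\<forall>i\<in>{1..n\<^sub>e}. is_lagrange_interpolant k N x \<xi>
           (\<lambda>y. u0 i (\<alpha> 0 + width \<alpha> \<beta> 0 * y)) (V i 0)"
      and V: "\<forall>i\<in>{1..n\<^sub>e}. \<forall>n\<in>{1..n\<^sub>i}. V i n \<in> fe_space k N x"
      and scheme: "\<forall>n\<in>{1..n\<^sub>i}. crank_nicolson_step n\<^sub>e T \<delta> \<alpha> \<beta> a f (fe_space k N x) V n"
      and i: "i \<in> {1..n\<^sub>e}" and n: "n \<in> {1..n\<^sub>i}"
    \<comment> \<open>At index 0 membership comes from the interpolation of the initial data, at
      later indices from the assumption on the solution.\<close>
    have V_fe: "V i l \<in> fe_space k N x" if "l \<le> n\<^sub>i" for l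
      using V V0 i that by (cases "l = 0") (auto simp: is_lagrange_interpolant_def)
    define e where "e l = (L2_norm (V i l))\<^sup>2" for l
    define G where "G l = L2_norm (\<lambda>y. pull_back \<alpha> \<beta> (f i) y (t_mid \<delta> l))" for l
    have step: "e l \<le> C1 * e (l - 1) + K * \<delta> * (G l)\<^sup>2" if l: "l \<in> {1..n\<^sub>i}" for l
    proof -
      \<comment> \<open>The midpoint has to lie in \<open>{0..T}\<close>, where the bounds on the
        width and its derivative hold.\<close>
      have "real l * \<delta> \<le> T" using l T assms(2) by (auto intro: mult_right_mono)
      moreover have "real (l - 1) * \<delta> \<le> real l * \<delta>" using assms(2) by (auto intro: mult_right_mono)
      moreover have "0 \<le> real (l - 1) * \<delta>" using assms(2) by simp
      ultimately have t: "t_mid \<delta> l \<in> {0..T}" by (simp add: t_mid_def)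
      have "L2_norm (V i l) - L2_norm (V i (l - 1))
          \<le> q * (L2_norm (V i l) + L2_norm (V i (l - 1))) + \<delta> * G l"
        unfolding q_def G_def
      proof (rule crank_nicolson_energy_bound[OF _ i part])
        show "crank_nicolson_step n\<^sub>e T \<delta> \<alpha> \<beta> a f (fe_space k N x) V l" using scheme l by blast
        show "0 \<le> a i s" if "s \<in> {1..n\<^sub>e} \<rightarrow>\<^sub>E UNIV" for s
          using a i that by (meson less_imp_le order_trans)
        show "\<gamma>0 \<le> width \<alpha> \<beta> (t_mid \<delta> l)" using width t by (blast intro: less_imp_le)
        show "\<bar>time_deriv T (width \<alpha> \<beta>) (t_mid \<delta> l)\<bar> \<le> \<mu>"
          using width' t by (force simp: \<mu>_def)
      qed (use V_fe g assms t i l in auto)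
      from squared_recursion[OF this L2_norm_nonneg \<open>q < 1\<close> \<open>0 < \<delta>\<close>] show ?thesis
        by (simp add: C1_def K_def e_def)
    qed
    have "e n \<le> C1 ^ n * e 0 + (\<Sum>l=1..n. C3 ^ (n - l + 2) * \<delta> * (G l)\<^sup>2)"
      using step \<open>0 < C1\<close> C3(2) \<open>K \<le> C3\<^sup>2\<close> assms(2) n
      by (intro discrete_Gronwall[where m = n\<^sub>i and K = K]) auto
    then show "(L2_norm (V i n))\<^sup>2 \<le> C1 ^ n * (L2_norm (V i 0))\<^sup>2
        + (\<Sum>l=1..n. C3 ^ (n - l + 2) * \<delta> *
            (L2_norm (\<lambda>y. pull_back \<alpha> \<beta> (f i) y (t_mid \<delta> l)))\<^sup>2)"
      unfolding e_def G_def .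
  qed
qed

end
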